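(* Let $r$ be a positive integer and let $H(r)$ be the smallest integer such that for every coloring of $\{1,\dots,H(r)\}$ with $r$ colors there exist $a,b,x,y\in\{1,\dots,H(r)\}$ with $a+b=xy$ such that the set $\{a,b,a+b,x,y,xy\}$ is monochromatic. Then $$2^{2^r}<H(r)<r^{r^{r^{3r}}}.$$ More generally, let $m,n$ be positive integers and put $N=R\big(n+1;\,r^{R(m+1;r)}\big)^{R(m+1;r)}$. Then for every coloring of $\{1,\dots,N\}$ with $r$ colors there exist $a_1,\dots,a_n,x_1,\dots,x_m\in\{1,\dots,N\}$ with $\sum_{i=1}^n a_i=\prod_{j=1}^m x_j$ such that the set $\{a_i:\ i\le n\}\cup\{x_j:\ j\le m\}\cup\{\sum_{i=1}^n a_i\}$ (whose last element equals $\prod_{j=1}^m x_j$) is monochromatic.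
   Context: For positive integers $k$ and $r$, $R(k;r)$ denotes the $r$-color Ramsey number for $k$-cliques: the smallest integer such that for every coloring with $r$ colors of the pairs $(i,j)$ with $1\le i<j\le R(k;r)$ there are indices $i_1<i_2<\dots<i_k$ such that all pairs $(i_g,i_h)$ with $g<h$ receive the same color.
   Formalization: The lower bound 2^{2^r} < H(r) is stated for r ≥ 3 and the upper bound for r ≥ 2, since as defined H(1) = 2 violates both bounds and H(2) ≤ 10 < 16 violates the lower one; the general statement is unrestricted. *)

theory Defs
  imports "HOL-Library.Ramsey"
begin

text \<open>
  A colouring with \<open>r\<close> colours is a function into \<open>{..<r}\<close> (not necessarily onto).
  The arrow \<open>partn_lst {1..N} (replicate r k) 2\<close> says that every such colouring of the
  two-element subsets \<open>{i, j}\<close> of \<open>{1..N}\<close>, i.e. of the pairs \<open>i < j\<close>, has a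
  \<open>k\<close>-element subset of \<open>{1..N}\<close> all of whose pairs receive the same colour.
\<close>

definition ramsey_number :: "nat \<Rightarrow> nat \<Rightarrow> nat" where
  "ramsey_number k r = (LEAST N. partn_lst {1..N} (replicate r k) 2)"

text \<open>
  Only elements of \<open>{1..N}\<close> carry a colour, so a set that is not contained in
  \<open>{1..N}\<close> is never monochromatic.
\<close>

definition mono_upto :: "nat \<Rightarrow> (nat \<Rightarrow> nat) \<Rightarrow> nat set \<Rightarrow> bool" where
  "mono_upto N c S \<longleftrightarrow> S \<subseteq> {1..N} \<and> (\<exists>q. \<forall>s\<in>S. c s = q)"

definition sum_product_unavoidable :: "nat \<Rightarrow> nat \<Rightarrow> bool" where
  "sum_product_unavoidable r N \<longleftrightarrow>
     (\<forall>c \<in> {1..N} \<rightarrow> {..<r}.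
        \<exists>a\<in>{1..N}. \<exists>b\<in>{1..N}. \<exists>x\<in>{1..N}. \<exists>y\<in>{1..N}.
          a + b = x * y \<and> mono_upto N c {a, b, a + b, x, y, x * y})"

definition sum_product_number :: "nat \<Rightarrow> nat" where
  "sum_product_number r = (LEAST N. sum_product_unavoidable r N)"

text \<open>
  The four numbers may coincide and may equal \<open>1\<close>; in particular \<open>1 + 1 = 1 * 2\<close> and
  \<open>2 + 2 = 2 * 2\<close> count. The next two facts show what this means for one and two colours:
  \<open>2 ^ (2 ^ r) < sum_product_number r\<close> fails for \<open>r = 1\<close> and \<open>r = 2\<close>, and
  \<open>sum_product_number r < r ^ (r ^ (r ^ (3 * r)))\<close> fails for \<open>r = 1\<close>.
\<close>

lemma sum_product_number_1: "sum_product_number 1 = 2"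
  unfolding sum_product_number_def
proof (rule Least_equality)
  show "sum_product_unavoidable 1 2"
    unfolding sum_product_unavoidable_def
  proof
    fix c :: "nat \<Rightarrow> nat"
    assume "c \<in> {1..2} \<rightarrow> {..<1}"
    then have "c i = 0" if "i \<in> {1..2}" for i
      using that by (auto simp: Pi_iff)
    then have "mono_upto 2 c {1, 1, 1 + 1, 1, 2, 1 * 2}"
      unfolding mono_upto_def by auto
    then show "\<exists>a\<in>{1..2}. \<exists>b\<in>{1..2}. \<exists>x\<in>{1..2}. \<exists>y\<in>{1..2}.
        a + b = x * y \<and> mono_upto 2 c {a, b, a + b, x, y, x * y}"
      by (intro bexI[of _ 2] bexI[of _ 1]) auto
  qed
next
  fix N assume N: "sum_product_unavoidable 1 N"
  have "(\<lambda>_. 0) \<in> {1..N} \<rightarrow> {..<1::nat}"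
    by simp
  with N obtain a b where "1 \<le> a" "1 \<le> b" "a + b \<le> N"
    unfolding sum_product_unavoidable_def mono_upto_def by force
  then show "2 \<le> N"
    by linarith
qed

lemma sum_product_number_2_le: "sum_product_number 2 \<le> 10"
  unfolding sum_product_number_def
proof (rule Least_le)
  show "sum_product_unavoidable 2 10"
    unfolding sum_product_unavoidable_def
  proof (rule ballI, rule ccontr)
    fix c :: "nat \<Rightarrow> nat"
    assume c: "c \<in> {1..10} \<rightarrow> {..<2}"
      and no: "\<not> (\<exists>a\<in>{1..10}. \<exists>b\<in>{1..10}. \<exists>x\<in>{1..10}. \<exists>y\<in>{1..10}.
        a + b = x * y \<and> mono_upto 10 c {a, b, a + b, x, y, x * y})"
    have two: "c j = c k" if "c i \<noteq> c j" "c i \<noteq> c k" "i \<in> {1..10}" "j \<in> {1..10}" "k \<in> {1..10}"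
      for i j k
    proof -
      have "c i < 2" "c j < 2" "c k < 2"
        using c that by (auto simp: Pi_iff)
      with that show ?thesis by linarith
    qed
    have avoid: "\<not> (c b = c a \<and> c s = c a \<and> c x = c a \<and> c y = c a)"
      if "a \<in> {1..10}" "b \<in> {1..10}" "x \<in> {1..10}" "y \<in> {1..10}" "s \<in> {1..10}"
        "a + b = s" "x * y = s" for a b x y s
    proof
      assume eq: "c b = c a \<and> c s = c a \<and> c x = c a \<and> c y = c a"
      have "mono_upto 10 c {a, b, a + b, x, y, x * y}"
        unfolding mono_upto_def using that eq by auto
      with no that show False by metis
    qed
    have 12: "c 1 \<noteq> c 2" using avoid[of 1 1 1 2 2] by auto
    have "c 2 \<noteq> c 4" using avoid[of 2 2 2 2 4] by auto
    then have 4: "c 4 = c 1" using two[of 2 4 1] 12 by auto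
    then have "c 3 \<noteq> c 1" using avoid[of 1 3 1 4 4] by auto
    then have 3: "c 3 = c 2" using two[of 1 3 2] 12 by auto
    have "c 5 \<noteq> c 1" using avoid[of 1 4 1 5 5] 4 by auto
    then have 5: "c 5 = c 2" using two[of 1 5 2] 12 by auto
    have "c 6 \<noteq> c 2" using avoid[of 3 3 2 3 6] 3 by auto
    then have 6: "c 6 = c 1" using two[of 2 6 1] 12 by auto
    have "c 10 \<noteq> c 2" using avoid[of 5 5 2 5 10] 5 by auto
    then have "c 10 = c 1" using two[of 2 10 1] 12 by auto
    with 4 6 show False using avoid[of 4 6 1 10 10] by auto
  qed
qed

end

theory Submission
  imports Defs
begin

text \<open>
  Put \<open>M = R(m+1; r)\<close> and \<open>K = R(n+1; r^M)\<close>. One chooses factors \<open>b\<^sub>1, b\<^sub>2, \<dots> \<le> K\<close> successively, each \<open>b\<^sub>h\<close>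
  being the diameter of an \<open>(n+1)\<close>-set whose differences \<open>d\<close>, for every \<open>g \<le> h\<close>, all give
  \<open>d b\<^sub>g \<cdots> b\<^sub>h\<^sub>-\<^sub>1\<close> the same colour. Ramsey's theorem for the pairs \<open>g < h\<close>, coloured by the colour of
  \<open>b\<^sub>g \<cdots> b\<^sub>h\<^sub>-\<^sub>1\<close>, gives consecutive blocks \<open>x\<^sub>1, \<dots>, x\<^sub>m\<close> of the same colour as their product. The last factor
  of this product is a sum of \<open>n\<close> consecutive differences, and replacing it by these differences
  yields the \<open>a\<^sub>i\<close>. The upper bound follows from \<open>R(3; r) \<le> 2 (r+1)!\<close>.

  For the lower bound, a colouring of \<open>{1..N}\<close> without solutions extends to \<open>{1..N\<^sup>2}\<close> with one more
  colour, so it suffices to colour \<open>{1..256}\<close> with three colours.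
\<close>

section \<open>Ramsey's theorem for pairs coloured from a finite set\<close>

text \<open>A colouring of \<open>B\<close> is pulled back along the injection \<open>h\<close>, and
  the homogeneous set found in \<open>A\<close> is mapped forward. This moves Ramsey's theorem from
  \<open>{..<N}\<close> to \<open>{1..N}\<close>.\<close>

lemma partn_lst_image:
  assumes "partn_lst A qs k" and "inj_on h A" and "h ` A \<subseteq> B"
  shows "partn_lst B qs k"
  unfolding partn_lst_def
proof
  fix f assume f: "f \<in> [B]\<^bsup>k\<^esup> \<rightarrow> {..<length qs}"
  have "f \<circ> (\<lambda>X. h ` X) \<in> [A]\<^bsup>k\<^esup> \<rightarrow> {..<length qs}"
    using f assms(2,3) by (intro nsets_compose_image_funcset) auto
  then obtain i H where i: "i < length qs" and H: "H \<in> [A]\<^bsup>(qs ! i)\<^esup>"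
    and sub: "(f \<circ> (\<lambda>X. h ` X)) ` [H]\<^bsup>k\<^esup> \<subseteq> {i}"
    using assms(1) unfolding partn_lst_def monochromatic_def by blast
  have HA: "H \<subseteq> A" using H by (simp add: nsets_def)
  have "h \<in> A \<rightarrow> B" using assms(3) by auto
  then have "h ` H \<in> [B]\<^bsup>(qs ! i)\<^esup>"
    using nsets_image_funcset[of h A B "qs ! i"] assms(2) H by blast
  moreover have "f ` [h ` H]\<^bsup>k\<^esup> \<subseteq> {i}"
  proof
    fix y assume "y \<in> f ` [h ` H]\<^bsup>k\<^esup>"
    then obtain X where X: "X \<in> [h ` H]\<^bsup>k\<^esup>" "y = f X" by blast
    then obtain Y where "Y \<in> [H]\<^bsup>k\<^esup>" "X = h ` Y"
      using nset_image_obtains[of X h H k] inj_on_subset[OF assms(2) HA] by blast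
    with X sub show "y \<in> {i}" by auto
  qed
  ultimately show "\<exists>i<length qs. monochromatic B (qs ! i) k f i"
    using i unfolding monochromatic_def by blast
qed

text \<open>Ramsey's theorem provides some \<open>N\<close> with the arrow property, so the
  \<open>LEAST\<close> in the definition is attained.\<close>

lemma partn_lst_ramsey_number:
  "partn_lst {1..ramsey_number k s} (replicate s k) 2"
proof -
  obtain N :: nat where "partn_lst {..<N} (replicate s k) 2"
    using ramsey_full by blast
  then have "partn_lst {1..N} (replicate s k) 2"
    by (rule partn_lst_image[where h = Suc]) auto
  then show ?thesis
    unfolding ramsey_number_def by (rule LeastI)
qed

text \<open>The form in which Ramsey's theorem is applied: colours may come from any set of at most
  \<open>s\<close> elements, such as vectors of colours, and the homogeneous set is listed
  increasingly as \<open>h 0 < ... < h k\<close>.\<close>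

lemma ramsey_number_pairs:
  fixes f :: "nat \<Rightarrow> nat \<Rightarrow> 'c"
  assumes f: "\<And>i j. 1 \<le> i \<Longrightarrow> i < j \<Longrightarrow> j \<le> ramsey_number (Suc k) s \<Longrightarrow> f i j \<in> C"
    and C: "finite C" "card C \<le> s"
  obtains h q where "strict_mono_on {..k} h" "h ` {..k} \<subseteq> {1..ramsey_number (Suc k) s}"
    "\<And>i j. i < j \<Longrightarrow> j \<le> k \<Longrightarrow> f (h i) (h j) = q"
proof -
  define R where "R = ramsey_number (Suc k) s"
  obtain e :: "'c \<Rightarrow> nat" where e: "inj_on e C" "e ` C \<subseteq> {..<s}"
    using C card_le_inj[of C "{..<s}"] by auto
  define F where "F X = e (f (Min X) (Max X))" for X
  have pair: "F {i, j} = e (f i j)" if "i < j" for i j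
    using that by (simp add: F_def)
  have "F \<in> [{1..R}]\<^bsup>2\<^esup> \<rightarrow> {..<length (replicate s (Suc k))}"
  proof
    fix X assume "X \<in> [{1..R}]\<^bsup>2\<^esup>"
    then obtain i j where "X = {i, j}" "1 \<le> i" "i < j" "j \<le> R"
      unfolding ordered_nsets_2_eq by auto
    then show "F X \<in> {..<length (replicate s (Suc k))}"
      using pair[of i j] e(2) f[of i j] unfolding R_def by (auto simp: image_subset_iff)
  qed
  then obtain p H where H: "H \<in> [{1..R}]\<^bsup>Suc k\<^esup>" and sub: "F ` [H]\<^bsup>2\<^esup> \<subseteq> {p}"
    using partn_lst_ramsey_number[of "Suc k" s]
    unfolding partn_lst_def monochromatic_def R_def[symmetric] by fastforce
  have fin: "finite H" and card: "card H = Suc k" and HR: "H \<subseteq> {1..R}"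
    using H by (auto simp: nsets_def)
  define h where "h i = sorted_list_of_set H ! i" for i
  have len: "length (sorted_list_of_set H) = Suc k"
    by (simp add: card)
  have sm: "h i < h j" if "i < j" "j \<le> k" for i j
    unfolding h_def using that len strict_sorted_list_of_set[of H]
    by (simp add: sorted_wrt_iff_nth_less)
  have hH: "h i \<in> H" if "i \<le> k" for i
    unfolding h_def using that len fin by (metis less_Suc_eq_le nth_mem set_sorted_list_of_set)
  have col: "e (f (h i) (h j)) = p" if "i < j" "j \<le> k" for i j
  proof -
    have "{h i, h j} \<in> [H]\<^bsup>2\<^esup>"
      using that hH sm[OF that] by auto
    then show ?thesis
      using sub pair[OF sm[OF that]] by (metis imageI singletonD subsetD)
  qed
  have inC: "f (h i) (h j) \<in> C" if "i < j" "j \<le> k" for i j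
    using f[of "h i" "h j"] sm[OF that] hH[of i] hH[of j] HR that unfolding R_def by force
  show thesis
  \<comment> \<open>For \<open>k = 0\<close> there are no pairs and this value is arbitrary.
    Otherwise injectivity of \<open>e\<close> on \<open>C\<close> turns equal codes into equal
    colours.\<close>
  proof (rule that[of h "f (h 0) (h 1)"])
    show "strict_mono_on {..k} h"
      using sm by (auto intro!: strict_mono_onI)
    show "h ` {..k} \<subseteq> {1..ramsey_number (Suc k) s}"
      using hH HR unfolding R_def by auto
    fix i j assume ij: "i < j" "j \<le> k"
    then show "f (h i) (h j) = f (h 0) (h 1)"
      using inj_onD[OF e(1), of "f (h i) (h j)" "f (h 0) (h 1)"] col[of i j] col[of 0 1]
        inC[of i j] inC[of 0 1] by auto
  qed
qed

section \<open>Dilated difference sets and the general sum-product theorem\<close>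

text \<open>
  The numbers \<open>d h n - d h 0\<close> are the factors \<open>b h\<close>; each set \<open>{d h 0, \<dots>, d h n}\<close> is found by
  colouring a pair \<open>i < j\<close> with the vector, indexed by \<open>g \<le> h\<close>, of the colours of
  \<open>(j - i) * b g * \<dots> * b (h - 1)\<close>.
\<close>

lemma dilated_differences:
  fixes c :: "nat \<Rightarrow> nat"
  assumes c: "c \<in> {1..K ^ M} \<rightarrow> {..<r}" and K: "K = ramsey_number (Suc n) (r ^ M)"
    and r: "r \<ge> 1" and n: "n \<ge> 1" and L: "L \<le> M"
  shows "\<exists>d. \<forall>h<L. strict_mono_on {..n} (d h) \<and> d h ` {..n} \<subseteq> {1..K} \<and>
    (\<forall>g\<le>h. \<forall>i j. i < j \<longrightarrow> j \<le> n \<longrightarrow>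
      c ((d h j - d h i) * (\<Prod>l=g..<h. d l n - d l 0)) =
      c ((d h n - d h 0) * (\<Prod>l=g..<h. d l n - d l 0)))"
  using L
proof (induction L)
  case (Suc L)
  then obtain d where d: "\<forall>h<L. strict_mono_on {..n} (d h) \<and> d h ` {..n} \<subseteq> {1..K} \<and>
    (\<forall>g\<le>h. \<forall>i j. i < j \<longrightarrow> j \<le> n \<longrightarrow>
      c ((d h j - d h i) * (\<Prod>l=g..<h. d l n - d l 0)) =
      c ((d h n - d h 0) * (\<Prod>l=g..<h. d l n - d l 0)))"
    by auto
  define b where "b l = d l n - d l 0" for l
  have b: "1 \<le> b l \<and> b l \<le> K" if "l < L" for l
  proof -
    have "strict_mono_on {..n} (d l)" "d l ` {..n} \<subseteq> {1..K}"
      using d that by auto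
    moreover from this have "d l 0 < d l n"
      using n by (auto simp: strict_mono_on_def)
    moreover from calculation have "d l n \<le> K" by auto
    ultimately show ?thesis unfolding b_def by linarith
  qed
  have P: "1 \<le> (\<Prod>l=g..<L. b l) \<and> (\<Prod>l=g..<L. b l) \<le> K ^ (L - g)" for g
  proof
    show "1 \<le> (\<Prod>l=g..<L. b l)"
      using b by (intro prod_ge_1) auto
    have "(\<Prod>l=g..<L. b l) \<le> (\<Prod>l=g..<L. K)"
      using b by (intro prod_mono) auto
    then show "(\<Prod>l=g..<L. b l) \<le> K ^ (L - g)" by simp
  qed
  define f where "f i j = (\<lambda>g\<in>{..L}. c ((j - i) * (\<Prod>l=g..<L. b l)))" for i j
  have "f i j \<in> {..L} \<rightarrow>\<^sub>E {..<r}" if "1 \<le> i" "i < j" "j \<le> K" for i j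
  proof -
    \<comment> \<open>One difference and \<open>L - g\<close> factors, each at most
      \<open>K\<close>: as \<open>Suc L \<le> M\<close>, the product stays in the domain of
      \<open>c\<close>. This is where the exponent \<open>M\<close> of \<open>N\<close> comes
      from.\<close>
    have "(j - i) * (\<Prod>l=g..<L. b l) \<in> {1..K ^ M}" if "g \<le> L" for g
    proof -
      have "(j - i) * (\<Prod>l=g..<L. b l) \<le> K * K ^ (L - g)"
        using P[of g] \<open>j \<le> K\<close> by (intro mult_le_mono) auto
      also have "\<dots> = K ^ Suc (L - g)" by simp
      also have "\<dots> \<le> K ^ M"
        using Suc.prems \<open>1 \<le> i\<close> \<open>i < j\<close> \<open>j \<le> K\<close> by (intro power_increasing) auto
      finally show ?thesis
        using P[of g] \<open>i < j\<close> by (auto simp: Suc_le_eq)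
    qed
    then show ?thesis
      using c unfolding f_def by (auto simp: Pi_iff)
  qed
  \<comment> \<open>The vectors have \<open>Suc L \<le> M\<close> coordinates, so one
    \<open>K\<close>, taken for \<open>r ^ M\<close> colours, serves at every stage.\<close>
  moreover have "card ({..L} \<rightarrow>\<^sub>E {..<r}) \<le> r ^ M"
    using Suc.prems r by (simp add: card_PiE power_increasing flip: power_Suc)
  moreover have "finite ({..L} \<rightarrow>\<^sub>E {..<r})"
    by (simp add: finite_PiE)
  ultimately obtain h q where h: "strict_mono_on {..n} h" "h ` {..n} \<subseteq> {1..K}"
    and q: "\<And>i j. i < j \<Longrightarrow> j \<le> n \<Longrightarrow> f (h i) (h j) = q"
    unfolding K using ramsey_number_pairs[of n "r ^ M" f "{..L} \<rightarrow>\<^sub>E {..<r}"] by metis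
  have new: "c ((h j - h i) * (\<Prod>l=g..<L. b l)) = c ((h n - h 0) * (\<Prod>l=g..<L. b l))"
    if "g \<le> L" "i < j" "j \<le> n" for g i j
  proof -
    \<comment> \<open>All pairs carry the same vector; coordinate \<open>g\<close> is compared with
      that of the extreme pair, whose difference is the new factor.\<close>
    have "f (h i) (h j) g = f (h 0) (h n) g"
      using q[of i j] q[of 0 n] that n by simp
    then show ?thesis
      using that(1) unfolding f_def by simp
  qed
  have eq: "(\<Prod>l=g..<k. (d(L := h)) l n - (d(L := h)) l 0) = (\<Prod>l=g..<k. b l)"
    if "k \<le> L" for g k
    using that unfolding b_def by (intro prod.cong) auto
  show ?case
  proof (intro exI[of _ "d(L := h)"] allI impI)
    fix k assume k: "k < Suc L"
    show "strict_mono_on {..n} ((d(L := h)) k) \<and> (d(L := h)) k ` {..n} \<subseteq> {1..K} \<and>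
      (\<forall>g\<le>k. \<forall>i j. i < j \<longrightarrow> j \<le> n \<longrightarrow>
        c (((d(L := h)) k j - (d(L := h)) k i) * (\<Prod>l=g..<k. (d(L := h)) l n - (d(L := h)) l 0)) =
        c (((d(L := h)) k n - (d(L := h)) k 0) * (\<Prod>l=g..<k. (d(L := h)) l n - (d(L := h)) l 0)))"
    proof (cases "k = L")
      case True
      have upd: "(d(L := h)) k = h" using True by simp
      show ?thesis
        unfolding upd eq[OF True[THEN eq_imp_le]] unfolding True
        by (intro conjI allI impI h) (rule new)
    next
      case False
      then have upd: "(d(L := h)) k = d k" and "k < L"
        using k by auto
      show ?thesis
        unfolding upd eq[OF less_imp_le[OF \<open>k < L\<close>]] unfolding b_def
        by (rule d[THEN spec, THEN mp, OF \<open>k < L\<close>])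
    qed
  qed
qed simp

lemma telescoping_prod_intervals:
  fixes b v :: "nat \<Rightarrow> nat"
  assumes "\<forall>i j. i < j \<longrightarrow> j \<le> m \<longrightarrow> v i < v j"
  shows "
    (\<Prod>j=1..m. \<Prod>l=v (j - 1)..<v j. b l) = (\<Prod>l=v 0..<v m. b l)"
  using assms
proof (induction m)
  case (Suc m)
  have "v 0 \<le> v m" using Suc.prems[rule_format, of 0 m] by (cases "m = 0") auto
  moreover have "v m \<le> v (Suc m)" using Suc.prems by (simp add: less_imp_le)
  ultimately show ?case
    using Suc by (simp add: prod.atLeastLessThan_concat)
qed simp

lemma telescoping_sum_differences:
  fixes d :: "nat \<Rightarrow> nat"
  assumes "\<forall>i j. i < j \<longrightarrow> j \<le> n \<longrightarrow> d i < d j"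
  shows "
    (\<Sum>i=1..n. d i - d (i - 1)) = d n - d 0"
  using assms
proof (induction n)
  case (Suc n)
  have "d 0 \<le> d n" using Suc.prems[rule_format, of 0 n] by (cases "n = 0") auto
  moreover have "d n \<le> d (Suc n)" using Suc.prems by (simp add: less_imp_le)
  ultimately show ?case
    using Suc by simp
qed simp

lemma monochromatic_sum_eq_prod:
  fixes r m n :: nat
  defines "M \<equiv> ramsey_number (m + 1) r"
  defines "N \<equiv> ramsey_number (n + 1) (r ^ M) ^ M"
  assumes r: "r \<ge> 1" and m: "m \<ge> 1" and n: "n \<ge> 1" and c: "c \<in> {1..N} \<rightarrow> {..<r}"
  shows "\<exists>a \<in> {1..n} \<rightarrow> {1..N}. \<exists>x \<in> {1..m} \<rightarrow> {1..N}.
    (\<Sum>i=1..n. a i) = (\<Prod>j=1..m. x j) \<and>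
    mono_upto N c (a ` {1..n} \<union> x ` {1..m} \<union> {\<Sum>i=1..n. a i})"
proof -
  define K where "K = ramsey_number (Suc n) (r ^ M)"
  have N: "N = K ^ M" by (simp add: N_def K_def)
  obtain d where d: "\<forall>h<M. strict_mono_on {..n} (d h) \<and> d h ` {..n} \<subseteq> {1..K} \<and>
    (\<forall>g\<le>h. \<forall>i j. i < j \<longrightarrow> j \<le> n \<longrightarrow>
      c ((d h j - d h i) * (\<Prod>l=g..<h. d l n - d l 0)) =
      c ((d h n - d h 0) * (\<Prod>l=g..<h. d l n - d l 0)))"
    using dilated_differences[OF c[unfolded N] K_def r n order.refl] by blast
  define b where "b l = d l n - d l 0" for l
  have less: "d h i < d h j" if "h < M" "i < j" "j \<le> n" for h i j
    using d that by (auto simp: strict_mono_on_def)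
  have le: "d h i \<le> K" if "h < M" "i \<le> n" for h i
    using d that by (auto simp: image_subset_iff)
  have col: "c ((d h j - d h i) * (\<Prod>l=g..<h. b l)) = c (b h * (\<Prod>l=g..<h. b l))"
    if "h < M" "g \<le> h" "i < j" "j \<le> n" for g h i j
    using d that unfolding b_def by blast
  have b: "1 \<le> b l \<and> b l \<le> K" if "l < M" for l
    using less[of l 0 n] le[of l n] that n unfolding b_def by auto
  have P: "(\<Prod>l=g..<h. b l) \<in> {1..N}" if "g < h" "h \<le> M" for g h
  proof -
    have "1 \<le> (\<Prod>l=g..<h. b l)"
      using b that by (intro prod_ge_1) auto
    moreover have "(\<Prod>l=g..<h. b l) \<le> (\<Prod>l=g..<h. K)"
      using b that by (intro prod_mono) auto
    moreover have "K ^ (h - g) \<le> K ^ M"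
      using b[of g] that by (intro power_increasing) auto
    ultimately show ?thesis by (simp add: N)
  qed
  \<comment> \<open>Cut points are at most \<open>M\<close>, so the factors of a block have index at
    most \<open>M - 1\<close>, the range in which \<open>d\<close> is controlled.\<close>
  have "c (\<Prod>l=g..<h. b l) \<in> {..<r}" if "1 \<le> g" "g < h" "h \<le> ramsey_number (Suc m) r" for g h
    using P[of g h] that c by (auto simp: M_def Pi_iff)
  then obtain v q where v: "strict_mono_on {..m} v" "v ` {..m} \<subseteq> {1..M}"
    and q: "\<And>i j. i < j \<Longrightarrow> j \<le> m \<Longrightarrow> c (\<Prod>l=v i..<v j. b l) = q"
    using ramsey_number_pairs[of m r "\<lambda>g h. c (\<Prod>l=g..<h. b l)" "{..<r}"]
    unfolding M_def Suc_eq_plus1[symmetric] by (metis card_lessThan finite_lessThan order.refl)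
  have vless: "v i < v j" if "i < j" "j \<le> m" for i j
    using v(1) that by (auto simp: strict_mono_on_def)
  have vM: "v i \<le> M" if "i \<le> m" for i
    using v(2) that by (auto simp: image_subset_iff)
  define x where "x j = (\<Prod>l=v (j - 1)..<v j. b l)" for j
  \<comment> \<open>The last factor \<open>b h\<close> of the full product is split off, and
    \<open>Q\<close> is the product of the others.\<close>
  define h where "h = v m - 1"
  have h: "v 0 \<le> h" "h < M" "v m = Suc h"
    using vless[of 0 m] vM[of m] m unfolding h_def by auto
  define Q where "Q = (\<Prod>l=v 0..<h. b l)"
  define a where "a i = (d h i - d h (i - 1)) * Q" for i
  have tot: "(\<Prod>l=v 0..<v m. b l) = b h * Q"
    using h by (simp add: Q_def mult.commute)
  have prod: "(\<Prod>j=1..m. x j) = b h * Q"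
    unfolding x_def tot[symmetric] by (rule telescoping_prod_intervals) (use vless in blast)
  have "(\<Sum>i=1..n. a i) = (\<Sum>i=1..n. d h i - d h (i - 1)) * Q"
    by (simp add: a_def sum_distrib_right)
  also have "(\<Sum>i=1..n. d h i - d h (i - 1)) = b h"
    unfolding b_def by (rule telescoping_sum_differences) (use less[OF h(2)] in blast)
  finally have sum: "(\<Sum>i=1..n. a i) = b h * Q" .
  have total: "b h * Q \<in> {1..N}" "c (b h * Q) = q"
    using P[of "v 0" "v m"] vless[of 0 m] vM[of m] q[of 0 m] m tot by auto
  have x: "x j \<in> {1..N} \<and> c (x j) = q" if "j \<in> {1..m}" for j
    using P[of "v (j - 1)" "v j"] vless[of "j - 1" j] vM[of j] q[of "j - 1" j] that
    unfolding x_def by auto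
  have a: "a i \<in> {1..N} \<and> c (a i) = q" if "i \<in> {1..n}" for i
  proof -
    have "Q \<ge> 1" using total(1) by (cases Q) auto
    then have "1 \<le> a i"
      using less[of h "i - 1" i] h that unfolding a_def by (auto simp: Suc_le_eq)
    \<comment> \<open>A summand is at most the sum, which is already known to lie in
      \<open>{1..N}\<close>.\<close>
    moreover have "a i \<le> b h * Q"
      unfolding sum[symmetric] using that by (intro member_le_sum) auto
    \<comment> \<open>Homogeneity of the set chosen at stage \<open>h\<close>, for products starting
      at \<open>g = v 0\<close>.\<close>
    moreover have "c (a i) = c (b h * Q)"
      using col[of h "v 0" "i - 1" i] h that unfolding a_def Q_def by auto
    ultimately show ?thesis using total by auto
  qed
  show ?thesis
  proof (rule bexI[of _ a], rule bexI[of _ x], intro conjI)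
    show "mono_upto N c (a ` {1..n} \<union> x ` {1..m} \<union> {\<Sum>i=1..n. a i})"
      unfolding mono_upto_def sum using a x total by blast
  qed (use a x sum prod in auto)
qed

section \<open>Triangle Ramsey numbers and the upper bound\<close>

lemma sum_product_unavoidable_ramsey:
  assumes "r \<ge> 1"
  shows "sum_product_unavoidable r (ramsey_number 3 (r ^ ramsey_number 3 r) ^ ramsey_number 3 r)"
    (is "sum_product_unavoidable r ?N")
  unfolding sum_product_unavoidable_def
proof
  fix c :: "nat \<Rightarrow> nat" assume "c \<in> {1..?N} \<rightarrow> {..<r}"
  then obtain a x :: "nat \<Rightarrow> nat" where a: "a \<in> {1..2} \<rightarrow> {1..?N}" and x: "x \<in> {1..2} \<rightarrow> {1..?N}"
    and eq: "(\<Sum>i=1..2. a i) = (\<Prod>j=1..2. x j)"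
    and mono: "mono_upto ?N c (a ` {1..2} \<union> x ` {1..2} \<union> {\<Sum>i=1..2. a i})"
    using monochromatic_sum_eq_prod[OF assms, of 2 2 c] by auto
  have two: "{1..2} = {1, 2::nat}" by auto
  have sum: "a 1 + a 2 = x 1 * x 2" using eq unfolding two by simp
  have "a ` {1..2} \<union> x ` {1..2} \<union> {\<Sum>i=1..2. a i} = {a 1, a 2, a 1 + a 2, x 1, x 2, x 1 * x 2}"
    unfolding two using sum by auto
  with mono have "mono_upto ?N c {a 1, a 2, a 1 + a 2, x 1, x 2, x 1 * x 2}"
    by simp
  moreover have "a 1 \<in> {1..?N}" "a 2 \<in> {1..?N}" "x 1 \<in> {1..?N}" "x 2 \<in> {1..?N}"
    using a x by (auto simp: Pi_iff)
  ultimately show "\<exists>a\<in>{1..?N}. \<exists>b\<in>{1..?N}. \<exists>x\<in>{1..?N}. \<exists>y\<in>{1..?N}.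
      a + b = x * y \<and> mono_upto ?N c {a, b, a + b, x, y, x * y}"
    using sum by blast
qed

text \<open>Induction on the number of colours. By pigeonhole a vertex \<open>v\<close> sends one
  colour \<open>q\<close> to many vertices. Either two of them are joined by \<open>q\<close>,
  closing a triangle with \<open>v\<close>, or they span only the remaining colours. Without
  colours, two vertices already contradict the hypotheses.\<close>

lemma mono_triangle:
  assumes "finite A" "finite C" "2 * fact (Suc (card C)) \<le> card A"
    and "\<And>x y. x \<in> A \<Longrightarrow> y \<in> A \<Longrightarrow> x \<noteq> y \<Longrightarrow> f {x, y} \<in> C"
  shows "\<exists>x\<in>A. \<exists>y\<in>A. \<exists>z\<in>A. x \<noteq> y \<and> x \<noteq> z \<and> y \<noteq> z \<and> f {x, y} = f {x, z} \<and> f {y, z} = f {x, z}"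
  using assms
proof (induction "card C" arbitrary: A C)
  case 0
  then have "C = {}" "2 \<le> card A" by auto
  then obtain x y where "x \<in> A" "y \<in> A" "x \<noteq> y"
    using card_le_Suc0_iff_eq[OF \<open>finite A\<close>] by force
  with 0 \<open>C = {}\<close> show ?case by blast
next
  case (Suc s)
  have "A \<noteq> {}"
    using Suc.prems(3) by (auto simp del: fact_Suc)
  then obtain v where v: "v \<in> A" by blast
  define B where "B q = {x \<in> A - {v}. f {v, x} = q}" for q
  have "\<exists>q\<in>C. 2 * fact (Suc s) \<le> card (B q)"
  proof (rule ccontr)
    assume "\<not> ?thesis"
    then have *: "card (B q) \<le> 2 * fact (Suc s) - 1" if "q \<in> C" for q
      using that by fastforce
    have "A - {v} = (\<Union>q\<in>C. B q)"
      using v Suc.prems(4) unfolding B_def by auto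
    then have "card A - 1 \<le> (\<Sum>q\<in>C. card (B q))"
      using v Suc.prems(1,2) by (metis card_Diff_singleton card_UN_le)
    also have "\<dots> \<le> card C * (2 * fact (Suc s) - 1)"
      using sum_bounded_above[of C "\<lambda>q. card (B q)"] * by auto
    finally have le: "card A - 1 \<le> Suc s * (2 * fact (Suc s) - 1)"
      using Suc.hyps(2) by simp
    \<comment> \<open>If all classes were smaller, then 2(s+2)F \<le> (s+1)(2F-1) + 1, that is 2F +
      s \<le> 0, which is impossible.\<close>
    define F :: nat where "F = fact (Suc s)"
    have "2 * (Suc (Suc s) * F) \<le> card A"
      using Suc.prems(3) unfolding F_def Suc.hyps(2)[symmetric] by (simp only: fact_Suc of_nat_id)
    with le have "2 * (Suc (Suc s) * F) \<le> Suc s * (2 * F - 1) + 1"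
      unfolding F_def by linarith
    moreover have "F \<ge> 1" by (simp add: F_def del: fact_Suc)
    moreover have "Suc s * (2 * F - 1) + Suc s = 2 * (Suc s * F)"
      using \<open>F \<ge> 1\<close> by (cases F) (auto simp: algebra_simps)
    moreover have "2 * (Suc (Suc s) * F) = 2 * (Suc s * F) + 2 * F"
      by (simp add: algebra_simps)
    ultimately show False by linarith
  qed
  then obtain q where q: "q \<in> C" and card: "2 * fact (Suc s) \<le> card (B q)"
    by blast
  show ?case
  proof (cases "\<exists>x\<in>B q. \<exists>y\<in>B q. x \<noteq> y \<and> f {x, y} = q")
    case True
    then obtain x y where "x \<in> B q" "y \<in> B q" "x \<noteq> y" "f {x, y} = q" by blast
    with v show ?thesis
      unfolding B_def by (intro bexI[of _ v] bexI[of _ x] bexI[of _ y]) auto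
  next
    case False
    have sub: "B q \<subseteq> A" unfolding B_def by auto
    have "card (C - {q}) = s"
      using Suc.hyps(2) q Suc.prems(2) by simp
    moreover have "f {x, y} \<in> C - {q}" if "x \<in> B q" "y \<in> B q" "x \<noteq> y" for x y
      using False that sub Suc.prems(4) by blast
    ultimately have "\<exists>x\<in>B q. \<exists>y\<in>B q. \<exists>z\<in>B q.
      x \<noteq> y \<and> x \<noteq> z \<and> y \<noteq> z \<and> f {x, y} = f {x, z} \<and> f {y, z} = f {x, z}"
      using Suc.prems(1,2) card finite_subset[OF sub]
      by (intro Suc.hyps(1)[of "C - {q}" "B q"]) (simp_all del: fact_Suc)
    with sub show ?thesis by (meson subsetD)
  qed
qed

lemma ramsey_number_3_le: "ramsey_number 3 s \<le> 2 * fact (Suc s)"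
  unfolding ramsey_number_def
proof (rule Least_le)
  define A where "A = {1..2 * fact (Suc s) :: nat}"
  have "partn_lst A (replicate s 3) 2"
    unfolding partn_lst_def
  proof
    fix f assume f: "f \<in> [A]\<^bsup>2\<^esup> \<rightarrow> {..<length (replicate s 3)}"
    have col: "f {x, y} \<in> {..<s}" if "x \<in> A" "y \<in> A" "x \<noteq> y" for x y
      using f that by (auto simp: Pi_iff)
    have "finite A" "2 * fact (Suc (card {..<s})) \<le> card A"
      by (simp_all add: A_def del: fact_Suc)
    then obtain x y z where "x \<in> A" "y \<in> A" "z \<in> A" and ne: "x \<noteq> y" "x \<noteq> z" "y \<noteq> z"
      and eq: "f {x, y} = f {x, z}" "f {y, z} = f {x, z}"
      using mono_triangle[of A "{..<s}" f] col by blast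
    then have "{x, y, z} \<in> [A]\<^bsup>3\<^esup>"
      by (auto simp: nsets_def)
    moreover have "f ` [{x, y, z}]\<^bsup>2\<^esup> \<subseteq> {f {x, z}}"
      using eq by (auto simp: nsets_2_eq insert_commute)
    moreover have "f {x, z} < s"
      using col ne \<open>x \<in> A\<close> \<open>z \<in> A\<close> by blast
    ultimately show "\<exists>i<length (replicate s 3). monochromatic A (replicate s 3 ! i) 2 f i"
      unfolding monochromatic_def by (intro exI[of _ "f {x, z}"]) auto
  qed
  then show "partn_lst {1..2 * fact (Suc s) :: nat} (replicate s 3) 2"
    unfolding A_def .
qed

text \<open>The induction step pairs the new factor s+2 with one factor s of \<open>s ^ s\<close>
  and uses s(s+2) \<le> (s+1)^2.\<close>

lemma fact_Suc_le: "s \<ge> 1 \<Longrightarrow> fact (Suc s) \<le> 2 * s ^ s"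
proof (induction s rule: nat_induct_at_least)
  case (Suc s)
  have "fact (Suc (Suc s)) = Suc (Suc s) * fact (Suc s)"
    by simp
  also have "\<dots> \<le> Suc (Suc s) * (2 * s ^ s)"
    using Suc.IH by (intro mult_le_mono) auto
  also have "s ^ s = s * s ^ (s - 1)"
    using Suc.hyps by (cases s) auto
  also have "Suc (Suc s) * (2 * (s * s ^ (s - 1))) = 2 * (s * Suc (Suc s) * s ^ (s - 1))"
    by (simp only: mult_ac)
  also have "\<dots> \<le> 2 * (Suc s ^ 2 * Suc s ^ (s - 1))"
    by (intro mult_le_mono power_mono) (auto simp: power2_eq_square)
  also have "Suc s ^ 2 * Suc s ^ (s - 1) = Suc s ^ Suc s"
    using Suc.hyps by (subst power_add[symmetric]) simp
  finally show ?case .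
qed simp

lemma ramsey_number_3_le_power: "s \<ge> 1 \<Longrightarrow> ramsey_number 3 s \<le> 4 * s ^ s"
  using ramsey_number_3_le[of s] fact_Suc_le[of s] by linarith

text \<open>With \<open>R = ramsey_number 3 r\<close> and \<open>s = r ^ R\<close>, the left side is
  at most \<open>r ^ (R * ((s + 2) * R))\<close>. Since \<open>R < s\<close> and
  \<open>s + 2 \<le> 2 * s\<close>, this exponent is below
  \<open>2 * s ^ 3 \<le> r ^ (3 * R + 1)\<close>, and
  \<open>3 * R + 1 \<le> 16 * r ^ r \<le> r ^ (3 * r)\<close>.\<close>

lemma ramsey_tower_bound:
  fixes r :: nat
  assumes r: "r \<ge> 2"
  shows "ramsey_number 3 (r ^ ramsey_number 3 r) ^ ramsey_number 3 r < r ^ (r ^ (r ^ (3 * r)))"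
proof (cases "ramsey_number 3 r = 0")
  \<comment> \<open>A zero exponent makes the left side 1; the main case can then assume
    \<open>R \<ge> 1\<close>.\<close>
  case True
  have "1 < r ^ (r ^ (r ^ (3 * r)))"
    using r by (intro one_less_power) auto
  with True show ?thesis by simp
next
  case False
  define R where "R = ramsey_number 3 r"
  define s where "s = r ^ R"
  have R: "R \<ge> 1" using False by (simp add: R_def)
  have s: "s \<ge> 2"
    unfolding s_def using r R self_le_power[of r R] by linarith
  have "R < 2 ^ R" by simp
  also have "(2::nat) ^ R \<le> s"
    unfolding s_def using r by (intro power_mono) auto
  finally have Rs: "R < s" .
  have "ramsey_number 3 s \<le> 4 * s ^ s"
    using s by (intro ramsey_number_3_le_power) auto
  also have "\<dots> \<le> s ^ 2 * s ^ s"
    using power_mono[OF s, of 2] by (intro mult_le_mono) auto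
  also have "\<dots> = s ^ (s + 2)" by (simp add: power2_eq_square)
  finally have "ramsey_number 3 s ^ R \<le> (s ^ (s + 2)) ^ R"
    by (intro power_mono) auto
  also have "\<dots> = r ^ (R * ((s + 2) * R))"
    unfolding s_def by (simp only: power_mult[symmetric] mult.assoc)
  finally have 1: "ramsey_number 3 s ^ R \<le> r ^ (R * ((s + 2) * R))" .
  have "R * ((s + 2) * R) \<le> R * ((s + s) * R)"
    using s by (intro mult_le_mono) auto
  also have "\<dots> < s * ((s + s) * s)"
    using Rs R s by (intro mult_strict_mono mult_strict_left_mono) auto
  also have "\<dots> = 2 * s ^ 3"
    by (simp add: power3_eq_cube algebra_simps)
  also have "\<dots> \<le> r * s ^ 3"
    using r by simp
  also have "\<dots> = r ^ (3 * R + 1)"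
    unfolding s_def by (simp add: power_mult[symmetric] mult.commute)
  finally have 2: "R * ((s + 2) * R) < r ^ (3 * R + 1)" .
  have "R \<le> 4 * r ^ r"
    unfolding R_def using r by (intro ramsey_number_3_le_power) auto
  moreover have "1 \<le> r ^ r" using r by simp
  ultimately have "3 * R + 1 \<le> 16 * r ^ r" by linarith
  also have "\<dots> = 2 ^ 4 * r ^ r" by simp
  also have "\<dots> \<le> r ^ 4 * r ^ r"
    using r by (intro mult_le_mono power_mono) auto
  also have "\<dots> = r ^ (4 + r)" by (simp add: power_add)
  also have "\<dots> \<le> r ^ (3 * r)"
    using r by (intro power_increasing) auto
  finally have "r ^ (3 * R + 1) \<le> r ^ (r ^ (3 * r))"
    using r by (intro power_increasing) auto
  with 2 have "R * ((s + 2) * R) < r ^ (r ^ (3 * r))" by linarith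
  then have "r ^ (R * ((s + 2) * R)) < r ^ (r ^ (r ^ (3 * r)))"
    using r by (intro power_strict_increasing) auto
  with 1 show ?thesis
    unfolding s_def R_def by linarith
qed

section \<open>Colourings without solutions and the lower bound\<close>

text \<open>Colourings restrict to \<open>{1..N}\<close>. Hence one avoidable number bounds the
  least unavoidable one strictly from below.\<close>

lemma sum_product_unavoidable_mono:
  assumes "sum_product_unavoidable r N" "N \<le> N'"
  shows "sum_product_unavoidable r N'"
  unfolding sum_product_unavoidable_def
proof
  fix c :: "nat \<Rightarrow> nat" assume "c \<in> {1..N'} \<rightarrow> {..<r}"
  then have "c \<in> {1..N} \<rightarrow> {..<r}"
    using assms(2) by (auto simp: Pi_iff)
  then obtain a b x y where "a \<in> {1..N}" "b \<in> {1..N}" "x \<in> {1..N}" "y \<in> {1..N}"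
    "a + b = x * y" "mono_upto N c {a, b, a + b, x, y, x * y}"
    using assms(1) unfolding sum_product_unavoidable_def by blast
  moreover have "{1..N} \<subseteq> {1..N'}" using assms(2) by auto
  ultimately have "a \<in> {1..N'}" "b \<in> {1..N'}" "x \<in> {1..N'}" "y \<in> {1..N'}"
    "mono_upto N' c {a, b, a + b, x, y, x * y}"
    unfolding mono_upto_def by (blast intro: order.trans)+
  with \<open>a + b = x * y\<close> show "\<exists>a\<in>{1..N'}. \<exists>b\<in>{1..N'}. \<exists>x\<in>{1..N'}. \<exists>y\<in>{1..N'}.
      a + b = x * y \<and> mono_upto N' c {a, b, a + b, x, y, x * y}"
    by blast
qed

text \<open>The new colour is given to the numbers in \<open>(N, N\<^sup>2]\<close>, which contain no product of two of them.\<close>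

lemma sum_product_avoidable_square:
  assumes "\<not> sum_product_unavoidable r N"
  shows "\<not> sum_product_unavoidable (Suc r) (N\<^sup>2)"
proof
  assume U: "sum_product_unavoidable (Suc r) (N\<^sup>2)"
  from assms obtain c where c: "c \<in> {1..N} \<rightarrow> {..<r}"
    and no: "\<And>a b x y. a \<in> {1..N} \<Longrightarrow> b \<in> {1..N} \<Longrightarrow> x \<in> {1..N} \<Longrightarrow> y \<in> {1..N} \<Longrightarrow>
      a + b = x * y \<Longrightarrow> \<not> mono_upto N c {a, b, a + b, x, y, x * y}"
    unfolding sum_product_unavoidable_def by blast
  define c' where "c' n = (if n \<le> N then c n else r)" for n
  have low: "c n < r" if "n \<in> {1..N}" for n using c that by auto
  then have "c' \<in> {1..N\<^sup>2} \<rightarrow> {..<Suc r}"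
    unfolding c'_def by (auto simp: less_Suc_eq)
  then obtain a b x y where "a + b = x * y" and mono: "mono_upto (N\<^sup>2) c' {a, b, a + b, x, y, x * y}"
    using U unfolding sum_product_unavoidable_def by blast
  define S where "S = {a, b, a + b, x, y, x * y}"
  obtain q where S: "S \<subseteq> {1..N\<^sup>2}" and q: "\<And>n. n \<in> S \<Longrightarrow> c' n = q"
    using mono unfolding mono_upto_def S_def by blast
  show False
  proof (cases "q = r")
    case True
    \<comment> \<open>Numbers up to \<open>N\<close> keep their old colour, which is less than
      \<open>r\<close>.\<close>
    then have "n > N" if "n \<in> S" for n
      using q[OF that] low[of n] S that unfolding c'_def by (force split: if_splits)
    then have "N < x" "N < y" unfolding S_def by auto
    then have "N * N < x * y" by (intro mult_strict_mono) auto
    moreover have "x * y \<le> N\<^sup>2" using S unfolding S_def by auto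
    ultimately show False by (simp add: power2_eq_square)
  next
    case False
    then have *: "n \<in> {1..N} \<and> c n = q" if "n \<in> S" for n
      using q[OF that] S that unfolding c'_def by (auto split: if_splits)
    then have "mono_upto N c S"
      unfolding mono_upto_def by blast
    with no[of a b x y] * \<open>a + b = x * y\<close> show False
      unfolding S_def by blast
  qed
qed

text \<open>
  The map \<open>n \<mapsto> n ^ 10\<close> is a quartic character modulo 41 with values 1, 9, 40, 32, where
  \<open>40 = -1\<close> and \<open>9\<^sup>2 = 32\<^sup>2 = -1\<close>. Hence colours 1 and 2 are product-free on the non-multiples
  of 41, and the fourth powers modulo 41 (colour 0) happen to be sum-free, which is what is needed
  of the class containing 1. The colours of the six multiples of 41 up to 256 are chosen by hand.
\<close>

definition residue_colour :: "nat \<Rightarrow> nat" where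
  "residue_colour n =
    (if n mod 41 = 0 then if n \<in> {41, 164, 246} then 2 else 1
     else if n ^ 10 mod 41 = 1 then 0 else if n ^ 10 mod 41 = 40 then 2 else 1)"

text \<open>By Fermat \<open>n ^ 40\<close> is 1 modulo 41, so \<open>n ^ 10\<close> is one of the
  four fourth roots of unity; the proof evaluates all forty residues.\<close>

lemma tenth_power_residues_41:
  fixes n :: nat
  assumes "n mod 41 \<noteq> 0"
  shows "n ^ 10 mod 41 \<in> {1, 9, 32, 40}"
proof -
  have "list_all (\<lambda>t. t ^ 10 mod 41 \<in> {1, 9, 32, 40}) [1..<41]"
    by (simp add: upt_conv_Cons del: One_nat_def)
  then have "\<forall>t\<in>set [1..<41]. t ^ 10 mod 41 \<in> {1, 9, 32, 40::nat}"
    unfolding list_all_iff .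
  moreover have "n mod 41 \<in> set [1..<41]"
    using assms by simp
  ultimately show ?thesis by (metis power_mod)
qed

lemma tenth_power_one_sum_free_41:
  assumes "a ^ 10 mod 41 = 1" "b ^ 10 mod 41 = (1::nat)"
  shows "(a + b) ^ 10 mod 41 \<noteq> 1"
proof -
  \<comment> \<open>The ten nonzero fourth powers modulo 41, which are the residues with tenth power
    1.\<close>
  define T where "T = {1, 4, 10, 16, 18, 23, 25, 31, 37, 40::nat}"
  have "list_all (\<lambda>t. t ^ 10 mod 41 = 1 \<longrightarrow> t \<in> T) [1..<41]"
    by (simp add: T_def upt_conv_Cons del: One_nat_def)
  then have "\<forall>t\<in>set [1..<41]. t ^ 10 mod 41 = 1 \<longrightarrow> t \<in> T"
    unfolding list_all_iff .
  moreover have "n mod 41 \<in> set [1..<41]" if "n ^ 10 mod 41 = 1" for n :: nat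
  proof -
    have "n mod 41 \<noteq> 0"
      using that power_mod[of n 41 10] by (intro notI) simp
    then show ?thesis by simp
  qed
  ultimately have inT: "n mod 41 \<in> T" if "n ^ 10 mod 41 = 1" for n
    using that by (metis power_mod)
  have "\<forall>s\<in>T. \<forall>t\<in>T. (s + t) mod 41 \<notin> T"
    by (simp add: T_def)
  then have "(a mod 41 + b mod 41) mod 41 \<notin> T"
    using inT[OF assms(1)] inT[OF assms(2)] by blast
  then have "(a + b) mod 41 \<notin> T"
    unfolding mod_add_eq .
  then show ?thesis
    using inT by blast
qed

text \<open>Away from multiples of 41 the colour depends only on the multiplicative character. If
  one factor is \<open>41 * k\<close> and the other is \<open>y\<close>, then
  \<open>k * y \<le> 6\<close> because 7 * 41 > 256, which leaves a finite check.\<close>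

lemma residue_colour_product_free:
  assumes "x * y \<le> 256" "1 \<le> x" "1 \<le> y"
    and "residue_colour x = q" "residue_colour y = q" "residue_colour (x * y) = q"
  shows "q = 0"
proof -
  have mult: "residue_colour (41 * k) \<noteq> residue_colour y \<or>
      residue_colour (41 * k * y) \<noteq> residue_colour y \<or> residue_colour y = 0"
    if "1 \<le> k" "1 \<le> y" "k * y \<le> 6" for k y :: nat
  proof -
    have "k \<le> k * y" "y \<le> k * y" using that(1,2) by simp_all
    then have "k \<le> 6" "y \<le> 6" using that(3) by linarith+
    with that(1,2) have "k \<in> set [1..<7]" "y \<in> set [1..<7]" by simp_all
    moreover have "list_all (\<lambda>k. list_all (\<lambda>y. k * y \<le> 6 \<longrightarrow>
        residue_colour (41 * k) \<noteq> residue_colour y \<or>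
        residue_colour (41 * k * y) \<noteq> residue_colour y \<or> residue_colour y = 0) [1..<7]) [1..<7]"
      by (simp add: upt_conv_Cons residue_colour_def del: One_nat_def)
    ultimately show ?thesis using that unfolding list_all_iff by metis
  qed
  have multiple: "q = 0" if "x mod 41 = 0" "x * y \<le> 256" "1 \<le> x" "1 \<le> y"
    "residue_colour x = q" "residue_colour y = q" "residue_colour (x * y) = q" for x y
  proof -
    from that(1) have "41 dvd x" by presburger
    then obtain k where k: "x = 41 * k" by (rule dvdE)
    have "41 * (k * y) \<le> 256" using that(2) k by (simp only: mult.assoc)
    then have "1 \<le> k" "k * y \<le> 6" using that(3) k by linarith+
    then show ?thesis
      using mult[of k y] that(4-7) unfolding k by metis
  qed
  show ?thesis
  proof (cases "x mod 41 = 0 \<or> y mod 41 = 0")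
    case True
    then show ?thesis
      using multiple[of x y] multiple[of y x] assms by (metis mult.commute)
  next
    case False
    then have x: "x ^ 10 mod 41 \<in> {1, 9, 32, 40}" and y: "y ^ 10 mod 41 \<in> {1, 9, 32, 40}"
      using tenth_power_residues_41 by auto
    have xy: "(x * y) ^ 10 mod 41 = ((x ^ 10 mod 41) * (y ^ 10 mod 41)) mod 41"
      by (simp add: power_mult_distrib mod_mult_eq)
    have "(x * y) mod 41 \<noteq> 0"
    \<comment> \<open>No two of the values 1, 9, 32, 40 have a product divisible by 41.\<close>
    proof
      assume "(x * y) mod 41 = 0"
      then have "(x * y) ^ 10 mod 41 = 0"
        by (metis power_mod power_zero_numeral mod_0)
      with xy have "(x ^ 10 mod 41) * (y ^ 10 mod 41) mod 41 = 0" by argo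
      with x y show False by (elim insertE emptyE) simp_all
    qed
    \<comment> \<open>The colour as a function of the character value, which reduces the claim to
      sixteen pairs of values.\<close>
    define K :: "nat \<Rightarrow> nat" where "K u = (if u = 1 then 0 else if u = 40 then 2 else 1)" for u
    have K: "residue_colour n = K (n ^ 10 mod 41)" if "n mod 41 \<noteq> 0" for n
      using that by (simp add: residue_colour_def K_def)
    have "K u = 0" if "u \<in> {1, 9, 32, 40}" "v \<in> {1, 9, 32, 40}" "K v = K u" "K (u * v mod 41) = K u"
      for u v :: nat
      using that unfolding K_def by (elim insertE emptyE) simp_all
    from this[OF x y] show ?thesis
      using K[of x] K[of y] K[of "x * y"] False \<open>(x * y) mod 41 \<noteq> 0\<close> assms(4-6) unfolding xy
      by metis
  qed
qed

text \<open>The product \<open>x * y\<close> rules out colours 1 and 2, and the sum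
  \<open>a + b\<close> rules out colour 0.\<close>

lemma sum_product_avoidable_3: "\<not> sum_product_unavoidable 3 256"
proof
  assume U: "sum_product_unavoidable 3 256"
  have "residue_colour \<in> {1..256} \<rightarrow> {..<3}"
    by (auto simp: residue_colour_def)
  then obtain a b x y where ran: "1 \<le> x" "1 \<le> y" and eq: "a + b = x * y"
    and mono: "mono_upto 256 residue_colour {a, b, a + b, x, y, x * y}"
    using U unfolding sum_product_unavoidable_def by (metis atLeastAtMost_iff)
  then obtain q where q: "residue_colour a = q" "residue_colour b = q" "residue_colour (a + b) = q"
    "residue_colour x = q" "residue_colour y = q" "residue_colour (x * y) = q" "x * y \<le> 256"
    unfolding mono_upto_def by auto
  from q(7) ran q(4-6) have "q = 0"
    by (rule residue_colour_product_free)
  have zero: "n mod 41 \<noteq> 0 \<and> n ^ 10 mod 41 = 1" if "residue_colour n = 0" for n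
    using that unfolding residue_colour_def by (simp split: if_splits)
  show False
    using tenth_power_one_sum_free_41[of a b] zero[of a] zero[of b] zero[of "a + b"]
      q(1-3) \<open>q = 0\<close> by simp
qed

text \<open>The induction starts from 256 = 2^(2^3); each further colour squares the bound and so
  doubles the exponent \<open>2 ^ r\<close>.\<close>

lemma sum_product_avoidable:
  "r \<ge> 3 \<Longrightarrow> \<not> sum_product_unavoidable r (2 ^ (2 ^ r))"
proof (induction r rule: nat_induct_at_least)
  case base
  then show ?case using sum_product_avoidable_3 by simp
next
  case (Suc r)
  have "(2 ^ (2 ^ r) :: nat)\<^sup>2 = 2 ^ (2 ^ Suc r)"
    by (simp add: power_mult[symmetric] mult.commute)
  with sum_product_avoidable_square[OF Suc.IH] show ?case by simp
qed

theorem theorem2: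
  fixes r :: nat
  assumes "r \<ge> 1"
  shows "(r \<ge> 3 \<longrightarrow> 2 ^ (2 ^ r) < sum_product_number r)
    \<and> (r \<ge> 2 \<longrightarrow> sum_product_number r < r ^ (r ^ (r ^ (3 * r))))
    \<and> (\<forall>m\<ge>1. \<forall>n\<ge>1. \<forall>N.
         N = ramsey_number (n + 1) (r ^ ramsey_number (m + 1) r) ^ ramsey_number (m + 1) r \<longrightarrow>
         (\<forall>c \<in> {1..N} \<rightarrow> {..<r}.
            \<exists>a \<in> {1..n} \<rightarrow> {1..N}. \<exists>x \<in> {1..m} \<rightarrow> {1..N}.
              (\<Sum>i=1..n. a i) = (\<Prod>j=1..m. x j) \<and>
              mono_upto N c (a ` {1..n} \<union> x ` {1..m} \<union> {\<Sum>i=1..n. a i})))"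
proof -
  have general: "\<forall>m\<ge>1. \<forall>n\<ge>1. \<forall>N.
         N = ramsey_number (n + 1) (r ^ ramsey_number (m + 1) r) ^ ramsey_number (m + 1) r \<longrightarrow>
         (\<forall>c \<in> {1..N} \<rightarrow> {..<r}.
            \<exists>a \<in> {1..n} \<rightarrow> {1..N}. \<exists>x \<in> {1..m} \<rightarrow> {1..N}.
              (\<Sum>i=1..n. a i) = (\<Prod>j=1..m. x j) \<and>
              mono_upto N c (a ` {1..n} \<union> x ` {1..m} \<union> {\<Sum>i=1..n. a i}))"
    by (intro allI impI ballI) (simp only: monochromatic_sum_eq_prod[OF assms])
  define N where "N = ramsey_number 3 (r ^ ramsey_number 3 r) ^ ramsey_number 3 r"
  have N: "sum_product_unavoidable r N"
    unfolding N_def by (rule sum_product_unavoidable_ramsey[OF assms])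
  have "sum_product_number r < r ^ (r ^ (r ^ (3 * r)))" if "r \<ge> 2"
    using Least_le[of "sum_product_unavoidable r" N] N ramsey_tower_bound[OF that]
    unfolding sum_product_number_def N_def by linarith
  moreover have "2 ^ (2 ^ r) < sum_product_number r" if "r \<ge> 3"
  proof (rule ccontr)
    assume "\<not> ?thesis"
    then have "sum_product_unavoidable r (2 ^ (2 ^ r))"
      using LeastI[of "sum_product_unavoidable r" N] N sum_product_unavoidable_mono
      unfolding sum_product_number_def by (meson not_less)
    with sum_product_avoidable[OF that] show False by contradiction
  qed
  ultimately show ?thesis
    using general by blast
qed

end
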